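(* a) $\sigma(\emptyset)=\emptyset$ and $\sigma(\widehat{\mathbb{R}})=\sigma(\mathbb{R})=\mathbb{R}$. Let $\widehat A,\widehat B\subseteq\widehat{\mathbb{R}}$. Then: b) $\sigma(\sigma(\widehat A))=\sigma(\widehat A)$. c) $\sigma(\widehat A\cup\widehat B)=\sigma(\widehat A)\cup\sigma(\widehat B)$. d) $\sigma(\widehat A\cap\widehat B)\subseteq\sigma(\widehat A)\cap\sigma(\widehat B)$ and $\sigma(\widehat A)\setminus\sigma(\widehat B)\subseteq\sigma(\widehat A\setminus\widehat B)$. If $\widehat A$ and $\widehat B$ are monads of subsets of $\mathbb{R}$, then $\sigma(\widehat A\cap\widehat B)=\sigma(\widehat A)\cap\sigma(\widehat B)$ and $\sigma(\widehat A\setminus\widehat B)=\sigma(\widehat A)\setminus\sigma(\widehat B)$. Let $\widehat{\mathbf A}\subseteq P(\widehat{\mathbb{R}})$ (i.e. $\widehat{\mathbf A}$ is a collection of subsets of $\widehat{\mathbb{R}}$). Then: e) $\sigma\left(\bigcup\{\widehat A\mid\widehat A\in\widehat{\mathbf A}\}\right)=\bigcup\{\sigma(\widehat A)\mid\widehat A\in\widehat{\mathbf A}\}$. f) $\sigma\left(\bigcap\{\widehat A\mid\widehat A\in\widehat{\mathbf A}\}\right)\subseteq\bigcap\{\sigma(\widehat A)\mid\widehat A\in\widehat{\mathbf A}\}$. If $\widehat{\mathbf A}$ is a collection of monads of subsets of $\mathbb{R}$, then $\sigma\left(\bigcap\{\widehat A\mid\widehat A\in\widehat{\mathbf A}\}\right)=\bigcap\{\sigma(\widehat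 A)\mid\widehat A\in\widehat{\mathbf A}\}$.
   Context: $\widehat{\mathbb{R}}$ is the set of all convergent sequences of real numbers (convergent for the usual absolute value); a real number is identified with the corresponding constant sequence, so $\mathbb{R}\subseteq\widehat{\mathbb{R}}$. The shadow $\sigma x\in\mathbb{R}$ of $x\in\widehat{\mathbb{R}}$ is the limit of $x$, and $x\approx y$ means $\sigma x=\sigma y$. For $\widehat A\subseteq\widehat{\mathbb{R}}$, the monad of $\widehat A$ is $m_{\approx}(\widehat A):=\{x\in\widehat{\mathbb{R}}\mid(\exists y\in\widehat A)\,x\approx y\}$ and the shadow of $\widehat A$ is $\sigma(\widehat A):=\{\sigma x\mid x\in\widehat A\}$. $P(\widehat{\mathbb{R}})$ denotes the set of all subsets of $\widehat{\mathbb{R}}$. *)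

theory Defs
  imports Complex_Main
begin

text \<open>
  The set of convergent real sequences is a type, so that the intersection of the empty
  collection of subsets is the set of all convergent sequences.
\<close>

typedef rhat = "{x :: nat \<Rightarrow> real. convergent x}"
  morphisms seq_of Abs_rhat
  by (auto intro: convergent_const)

setup_lifting type_definition_rhat

text \<open>The identification of a real number with a constant sequence is made explicit.\<close>

lift_definition const_rhat :: "real \<Rightarrow> rhat" is "\<lambda>r (_ :: nat). r"
  by (rule convergent_const)

definition real_in_rhat :: "real set \<Rightarrow> rhat set" where
  "real_in_rhat S = const_rhat ` S"

definition shadow :: "rhat \<Rightarrow> real" where
  "shadow x = lim (seq_of x)"

definition approx_eq :: "rhat \<Rightarrow> rhat \<Rightarrow> bool"  (infix "\<approx>" 50) where
  "x \<approx> y \<longleftrightarrow> shadow x = shadow y"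

definition monad :: "rhat set \<Rightarrow> rhat set" where
  "monad A = {x. \<exists>y\<in>A. x \<approx> y}"

definition Shadow :: "rhat set \<Rightarrow> real set" where
  "Shadow A = {shadow x | x. x \<in> A}"

definition is_monad_of_reals :: "rhat set \<Rightarrow> bool" where
  "is_monad_of_reals A \<longleftrightarrow> (\<exists>S :: real set. A = monad (real_in_rhat S))"

end

theory Submission
  imports Defs
begin

text \<open>
  The shadow map has the constant sequences as a section, hence is surjective, and the monads of
  sets of reals are exactly its preimages \<open>shadow -` S\<close>. All claims are therefore facts about images
  under a surjection; intersections and differences are preserved on preimages, where membership
  of a sequence depends on its shadow alone.
\<close>

lemma shadow_const_rhat [simp]: "shadow (const_rhat r) = r"
  by (simp add: shadow_def const_rhat.rep_eq)

lemma Shadow_eq_image: "Shadow A = shadow ` A"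
  by (auto simp: Shadow_def)

lemma Shadow_real_in_rhat [simp]: "Shadow (real_in_rhat S) = S"
  by (simp add: Shadow_eq_image real_in_rhat_def image_image)

lemma Shadow_UNIV [simp]: "Shadow UNIV = UNIV"
  unfolding Shadow_eq_image by (rule surjI) (rule shadow_const_rhat)

lemma monad_real_in_rhat: "monad (real_in_rhat S) = shadow -` S"
  by (auto simp: monad_def real_in_rhat_def approx_eq_def)

text \<open>A preimage under \<open>shadow\<close> contains the whole fibre over each of its points,
  so a sequence sharing its shadow with some member of \<open>A\<close> is itself a member.\<close>

lemma is_monad_of_reals_mem_iff:
  assumes "is_monad_of_reals A"
  shows "x \<in> A \<longleftrightarrow> shadow x \<in> Shadow A"
  using assms by (auto simp: is_monad_of_reals_def monad_real_in_rhat Shadow_eq_image)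

lemma Shadow_Inter_monads:
  assumes "\<And>C. C \<in> \<A> \<Longrightarrow> is_monad_of_reals C"
  shows "Shadow (\<Inter>\<A>) = (\<Inter>C\<in>\<A>. Shadow C)"
proof
  show "Shadow (\<Inter>\<A>) \<subseteq> (\<Inter>C\<in>\<A>. Shadow C)"
    by (auto simp: Shadow_eq_image)
  show "(\<Inter>C\<in>\<A>. Shadow C) \<subseteq> Shadow (\<Inter>\<A>)"
  proof
    fix r assume "r \<in> (\<Inter>C\<in>\<A>. Shadow C)"
    \<comment> \<open>The members of \<open>\<A>\<close> may attain \<open>r\<close> at different
      sequences. As each is a union of fibres, the constant sequence serves as one witness for all
      of them, and also when \<open>\<A>\<close> is empty.\<close>
    then have "const_rhat r \<in> \<Inter>\<A>"
      using assms is_monad_of_reals_mem_iff by auto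
    then show "r \<in> Shadow (\<Inter>\<A>)"
      unfolding Shadow_eq_image by (metis imageI shadow_const_rhat)
  qed
qed

lemma Shadow_Int_monads:
  assumes "is_monad_of_reals A" "is_monad_of_reals B"
  shows "Shadow (A \<inter> B) = Shadow A \<inter> Shadow B"
  using Shadow_Inter_monads[of "{A, B}"] assms by auto

text \<open>Removing \<open>B\<close> deletes entire fibres of \<open>shadow\<close>, so no sequence
  left over can still have its shadow in \<open>Shadow B\<close>.\<close>

lemma Shadow_Diff_monad:
  assumes "is_monad_of_reals B"
  shows "Shadow (A - B) = Shadow A - Shadow B"
proof -
  have "A - B = {x \<in> A. shadow x \<notin> Shadow B}"
    using is_monad_of_reals_mem_iff[OF assms] by blast
  then show ?thesis
    by (auto simp: Shadow_def)
qed

theorem proposition4p6: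
  fixes A B :: "rhat set" and \<A> :: "rhat set set"
  shows
    "(Shadow {} = {} \<and> Shadow (UNIV :: rhat set) = Shadow (real_in_rhat UNIV)
        \<and> Shadow (real_in_rhat UNIV) = (UNIV :: real set)) \<and>
     Shadow (real_in_rhat (Shadow A)) = Shadow A \<and>
     Shadow (A \<union> B) = Shadow A \<union> Shadow B \<and>
     (Shadow (A \<inter> B) \<subseteq> Shadow A \<inter> Shadow B \<and>
      Shadow A - Shadow B \<subseteq> Shadow (A - B) \<and>
      (is_monad_of_reals A \<and> is_monad_of_reals B \<longrightarrow>
         Shadow (A \<inter> B) = Shadow A \<inter> Shadow B \<and>
         Shadow (A - B) = Shadow A - Shadow B)) \<and>
     Shadow (\<Union>\<A>) = \<Union>{Shadow C | C. C \<in> \<A>} \<and>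
     (Shadow (\<Inter>\<A>) \<subseteq> \<Inter>{Shadow C | C. C \<in> \<A>} \<and>
      ((\<forall>C\<in>\<A>. is_monad_of_reals C) \<longrightarrow>
         Shadow (\<Inter>\<A>) = \<Inter>{Shadow C | C. C \<in> \<A>}))"
proof (intro conjI impI)
  show "Shadow (A \<inter> B) = Shadow A \<inter> Shadow B" "Shadow (A - B) = Shadow A - Shadow B"
    if "is_monad_of_reals A \<and> is_monad_of_reals B"
    using that by (simp_all add: Shadow_Int_monads Shadow_Diff_monad)
  show "Shadow (\<Inter>\<A>) = \<Inter>{Shadow C | C. C \<in> \<A>}" if "\<forall>C\<in>\<A>. is_monad_of_reals C"
    using that by (simp add: Shadow_Inter_monads Setcompr_eq_image)
  \<comment> \<open>From here to \<open>Shadow {} = {}\<close>, the claims hold for images under any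
    map.\<close>
  show "Shadow (\<Union>\<A>) = \<Union>{Shadow C | C. C \<in> \<A>}"
    unfolding Shadow_eq_image by blast
  show "Shadow (\<Inter>\<A>) \<subseteq> \<Inter>{Shadow C | C. C \<in> \<A>}"
    unfolding Shadow_eq_image by blast
  show "Shadow (A \<union> B) = Shadow A \<union> Shadow B" "Shadow (A \<inter> B) \<subseteq> Shadow A \<inter> Shadow B"
    "Shadow A - Shadow B \<subseteq> Shadow (A - B)" "Shadow {} = {}"
    unfolding Shadow_eq_image by blast+
\<comment> \<open>What remains is a) for the full sets and b), which rest on the constant sequences
  being a section of \<open>shadow\<close>.\<close>
qed simp_all

end
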